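(* Let $p>0$ and let $u:\mathbb{R}^4\to\mathbb{R}$ be a solution to $\Delta^2 u=(1-|x|^p)e^{4u}$ in $\mathbb{R}^4$ with $(1-|y|^p)e^{4u}\in L^1(\mathbb{R}^4)$, $\Lambda:=\int_{\mathbb{R}^4}(1-|x|^p)e^{4u}dx$, and $$v(x):=\frac{1}{8\pi^2}\int_{\mathbb{R}^4}\log\left(\frac{|y|}{|x-y|}\right)(1-|y|^p)e^{4u(y)}\,dy.$$ Assume $v\in L^1_{loc}(\mathbb{R}^4)$ and that for every $\varepsilon>0$ there is $R>0$ such that for all $|x|\ge R$, $$-v(x)\le\frac{1}{8\pi^2}(\Lambda+5\varepsilon)\log|x|+\frac{1}{8\pi^2}\int_{B_1(x)}\log(|x-y|)(1-|y|^p)e^{4u(y)}\,dy.$$ Let $h:\mathbb{R}^4\to\mathbb{R}$ satisfy $\Delta^2h=0$ and $h\le u-v$ on $\mathbb{R}^4$. Then $h$ is a polynomial of degree at most $2$.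
   Context: $B_1(x)$ denotes the ball of radius $1$ centered at $x$. *)

theory Defs
  imports "HOL-Analysis.Analysis"
begin

definition pdiff :: "'n::finite \<Rightarrow> (real^'n \<Rightarrow> real) \<Rightarrow> real^'n \<Rightarrow> real" where
  "pdiff i f x = deriv (\<lambda>t. f (x + t *\<^sub>R axis i 1)) 0"

fun Ck :: "nat \<Rightarrow> (real^'n::finite \<Rightarrow> real) \<Rightarrow> bool" where
  "Ck 0 f = continuous_on UNIV f"
| "Ck (Suc k) f = (continuous_on UNIV f \<and>
      (\<forall>i x. (\<lambda>t. f (x + t *\<^sub>R axis i 1)) differentiable (at 0)) \<and>
      (\<forall>i. Ck k (pdiff i f)))"

definition laplacian :: "(real^'n::finite \<Rightarrow> real) \<Rightarrow> real^'n \<Rightarrow> real" where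
  "laplacian f x = (\<Sum>i\<in>UNIV. pdiff i (pdiff i f) x)"

definition bilaplacian :: "(real^'n::finite \<Rightarrow> real) \<Rightarrow> real^'n \<Rightarrow> real" where
  "bilaplacian f = laplacian (laplacian f)"

end

(*
  Averages of a C^4 biharmonic h against the bumps (1 - |y|^2)_+^N satisfy Pizzetti's formula: the
  average over scale R is a h(x) + b R^2 Lap h(x). The R-derivative of the average is, after one
  integration by parts, an average of the Laplacian with the next bump, which gives the formula.
  A combination of the scales R and 2R removes the Laplacian; moving three derivatives onto the
  kernel bounds |D^3 h(x)| by C R^-3 times the average of |h| = 2 h^+ - h. The average of h is
  O(R^2) by Pizzetti, and that of h^+ is O(R^2) as soon as h <= C (1 + |z|^2) + E(z) with E
  integrable; hence D^3 h = 0.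

  For h <= u - v the hypothesis on v gives such an E: u <= e^{4u}, which is dominated by the
  integrable |1 - |z|^p| e^{4u} away from the unit ball, and the local logarithmic potential is
  integrable by Tonelli.
*)
theory Submission
  imports Defs
begin

section \<open>Functions with continuous partial derivatives\<close>

definition grad :: "(real^'n::finite \<Rightarrow> real) \<Rightarrow> real^'n \<Rightarrow> real^'n" where
  "grad f x = (\<chi> i. pdiff i f x)"

lemma DERIV_pdiff:
  assumes "\<And>x. (\<lambda>t. f (x + t *\<^sub>R axis i 1)) differentiable (at 0)"
  shows "((\<lambda>t. f (x + t *\<^sub>R axis i 1)) has_real_derivative pdiff i f (x + s *\<^sub>R axis i 1)) (at s)"
proof -
  have "((\<lambda>t. f ((x + s *\<^sub>R axis i 1) + t *\<^sub>R axis i 1)) has_real_derivative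
          pdiff i f (x + s *\<^sub>R axis i 1)) (at 0)"
    using assms unfolding pdiff_def
    by (metis DERIV_deriv_iff_real_differentiable)
  then have "((\<lambda>t. f (x + (t + s) *\<^sub>R axis i 1)) has_real_derivative
          pdiff i f (x + s *\<^sub>R axis i 1)) (at 0)"
    by (simp add: algebra_simps)
  then show ?thesis
    using DERIV_shift[of "\<lambda>t. f (x + t *\<^sub>R axis i 1)" _ 0 s] by simp
qed

text \<open>Telescoping along the coordinate axes, one index of \<open>S\<close> at a time.\<close>

lemma partial_increments:
  fixes f :: "real^'n::finite \<Rightarrow> real"
  assumes d: "\<And>i x. (\<lambda>t. f (x + t *\<^sub>R axis i 1)) differentiable (at 0)"
    and c: "\<And>i. continuous_on UNIV (pdiff i f)"
    and "finite S" "e > 0"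
  shows "\<exists>\<delta>>0. \<forall>z. norm z < \<delta> \<longrightarrow>
    \<bar>f (x + (\<Sum>i\<in>S. z$i *\<^sub>R axis i 1)) - f x - (\<Sum>i\<in>S. z$i * pdiff i f x)\<bar> \<le> e * norm z"
  using assms(3,4)
proof (induction S arbitrary: e rule: finite_induct)
  case empty
  then show ?case by (auto intro!: exI[of _ 1])
next
  case (insert i S)
  let ?P = "\<lambda>z::real^'n. \<Sum>i\<in>S. z$i *\<^sub>R axis i (1::real)"
  obtain \<delta>1 where \<delta>1: "\<delta>1 > 0" "\<And>w. dist w x < \<delta>1 \<Longrightarrow> \<bar>pdiff i f w - pdiff i f x\<bar> \<le> e/2"
    using c[of i] \<open>e > 0\<close> unfolding continuous_on_iff dist_real_def
    by (metis UNIV_I half_gt_zero less_eq_real_def)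
  obtain \<delta>2 where \<delta>2: "\<delta>2 > 0" "\<And>z. norm z < \<delta>2 \<Longrightarrow>
      \<bar>f (x + ?P z) - f x - (\<Sum>i\<in>S. z$i * pdiff i f x)\<bar> \<le> e/2 * norm z"
    using insert.IH[of "e/2"] insert.prems by auto
  \<comment> \<open>Moving along the coordinates in \<open>S\<close> and then along axis
    \<open>i\<close> displaces \<open>x\<close> by at most (card S + 1) |z|, so this choice keeps
    the displacement below \<open>\<delta>1\<close>.\<close>
  define \<delta> where "\<delta> = min \<delta>2 (\<delta>1 / (real (card S) + 1))"
  have "\<delta> > 0" using \<delta>1 \<delta>2 by (simp add: \<delta>_def add_nonneg_pos)
  moreover have "\<bar>f (x + (\<Sum>i\<in>insert i S. z$i *\<^sub>R axis i 1)) - f x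
       - (\<Sum>i\<in>insert i S. z$i * pdiff i f x)\<bar> \<le> e * norm z" if z: "norm z < \<delta>" for z
  proof -
    have nP: "norm (?P z) \<le> real (card S) * norm z"
      by (rule order_trans[OF norm_sum])
         (use sum_bounded_above[of S "\<lambda>i. \<bar>z$i\<bar>" "norm z"] in \<open>simp add: component_le_norm_cart\<close>)
    define J where "J = {- \<bar>z$i\<bar> .. \<bar>z$i\<bar>}"
    \<comment> \<open>Subtracting the linear term leaves a function of one variable whose derivative
      is at most e/2 in absolute value on \<open>J\<close>; the mean value inequality then controls
      the increment along axis \<open>i\<close>.\<close>
    define g where "g = (\<lambda>t. f (x + ?P z + t *\<^sub>R axis i 1) - t * pdiff i f x)"
    have "norm (g (z$i) - g 0) \<le> e/2 * norm (z$i - 0)"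
    proof (rule field_differentiable_bound)
      show "convex J" by (simp add: J_def)
      fix t assume t: "t \<in> J"
      show "(g has_field_derivative (pdiff i f (x + ?P z + t *\<^sub>R axis i 1) - pdiff i f x)) (at t within J)"
        unfolding g_def
        by (rule has_field_derivative_at_within)
           (auto intro!: derivative_eq_intros DERIV_pdiff d)
      have "\<bar>t\<bar> \<le> norm z" using t component_le_norm_cart[of z i] by (auto simp: J_def)
      then have "norm (?P z + t *\<^sub>R axis i 1) \<le> (real (card S) + 1) * norm z"
        using norm_triangle_ineq[of "?P z" "t *\<^sub>R axis i 1"] nP by (simp add: algebra_simps)
      also have "\<dots> < \<delta>1"
        using z by (simp add: \<delta>_def pos_less_divide_eq add_nonneg_pos mult.commute)
      finally have "dist (x + ?P z + t *\<^sub>R axis i 1) x < \<delta>1" by (simp add: dist_norm add.assoc)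
      from \<delta>1(2)[OF this]
      show "norm (pdiff i f (x + ?P z + t *\<^sub>R axis i 1) - pdiff i f x) \<le> e/2" by simp
    qed (auto simp: J_def)
    also have "\<dots> \<le> e/2 * norm z"
      using component_le_norm_cart[of z i] \<open>e > 0\<close> by simp
    finally have 1: "\<bar>f (x + ?P z + z$i *\<^sub>R axis i 1) - f (x + ?P z) - z$i * pdiff i f x\<bar> \<le> e/2 * norm z"
      by (simp add: g_def algebra_simps)
    have 2: "\<bar>f (x + ?P z) - f x - (\<Sum>i\<in>S. z$i * pdiff i f x)\<bar> \<le> e/2 * norm z"
      using \<delta>2(2)[of z] z by (simp add: \<delta>_def)
    have eq: "x + (\<Sum>i\<in>insert i S. z$i *\<^sub>R axis i 1) = x + ?P z + z$i *\<^sub>R axis i 1"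
      using insert.hyps by (simp add: algebra_simps)
    have s: "(\<Sum>i\<in>insert i S. z$i * pdiff i f x) = z$i * pdiff i f x + (\<Sum>i\<in>S. z$i * pdiff i f x)"
      using insert.hyps by simp
    show ?thesis
      unfolding eq s using 1 2 by linarith
  qed
  ultimately show ?case by blast
qed

text \<open>\<open>Ck\<close> speaks of partial derivatives only, while the chain rule along curves
  needs the total derivative. Running \<open>partial_increments\<close> over all coordinates
  supplies it.\<close>

lemma GDERIV_grad:
  fixes f :: "real^'n::finite \<Rightarrow> real"
  assumes "Ck (Suc k) f"
  shows "GDERIV f x :> grad f x"
proof -
  have d: "\<And>i x. (\<lambda>t. f (x + t *\<^sub>R axis i 1)) differentiable (at 0)"
    and C: "\<And>i. Ck k (pdiff i f)" using assms by auto
  have c: "continuous_on UNIV (pdiff i f)" for i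
    using C[of i] by (cases k) auto
  have "\<exists>\<delta>>0. \<forall>y. norm (y - x) < \<delta> \<longrightarrow>
    norm (f y - f x - (y - x) \<bullet> grad f x) \<le> e * norm (y - x)" if "e > 0" for e
  proof -
    obtain \<delta> where \<delta>: "\<delta> > 0" "\<And>z. norm z < \<delta> \<Longrightarrow> \<bar>f (x + (\<Sum>i\<in>UNIV. z$i *\<^sub>R axis i 1)) - f x
        - (\<Sum>i\<in>UNIV. z$i * pdiff i f x)\<bar> \<le> e * norm z"
      using partial_increments[OF d c finite \<open>e > 0\<close>] by blast
    have s: "(\<Sum>i\<in>UNIV. z$i *\<^sub>R axis i 1) = z" for z :: "real^'n"
      using basis_expansion[of z] by (simp add: scalar_mult_eq_scaleR)
    show ?thesis
      using \<delta>(1) \<delta>(2)[of "y - x" for y] unfolding s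
      by (intro exI[of _ \<delta>]) (auto simp: inner_vec_def grad_def)
  qed
  then show ?thesis
    unfolding gderiv_def has_derivative_at_alt by (auto intro!: bounded_linear_intros)
qed

lemma Ck_imp_continuous: "Ck k f \<Longrightarrow> continuous_on UNIV f"
  by (cases k) auto

lemma Ck_pdiff: "Ck (Suc k) f \<Longrightarrow> Ck k (pdiff i f)"
  by simp

lemma continuous_grad: "Ck (Suc k) f \<Longrightarrow> continuous_on UNIV (grad f)"
  unfolding grad_def[abs_def]
  by (intro continuous_on_vec_lambda Ck_imp_continuous[OF Ck_pdiff])

lemma Ck_Suc_imp_Ck: "Ck (Suc k) f \<Longrightarrow> Ck k f"
  by (induction k arbitrary: f) auto

lemma pdiff_add:
  assumes "\<And>x. (\<lambda>t. f (x + t *\<^sub>R axis i 1)) differentiable (at 0)"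
    and "\<And>x. (\<lambda>t. g (x + t *\<^sub>R axis i 1)) differentiable (at 0)"
  shows "pdiff i (\<lambda>x. f x + g x) = (\<lambda>x. pdiff i f x + pdiff i g x)"
proof
  fix x
  show "pdiff i (\<lambda>x. f x + g x) x = pdiff i f x + pdiff i g x"
    unfolding pdiff_def[of i "\<lambda>x. f x + g x"]
    by (rule DERIV_imp_deriv)
       (use DERIV_add[OF DERIV_pdiff[OF assms(1), of x 0] DERIV_pdiff[OF assms(2), of x 0]] in simp)
qed

lemma Ck_add: "Ck k f \<Longrightarrow> Ck k g \<Longrightarrow> Ck k (\<lambda>x. f x + g x)"
  by (induction k arbitrary: f g)
     (auto intro!: continuous_intros simp: pdiff_add)

lemma pdiff_const [simp]: "pdiff i (\<lambda>x. c) = (\<lambda>x. 0)"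
  by (simp add: pdiff_def fun_eq_iff)

lemma Ck_const: "Ck k (\<lambda>x. c)"
  by (induction k arbitrary: c) auto

lemma Ck_sum: "finite S \<Longrightarrow> (\<And>i. i \<in> S \<Longrightarrow> Ck k (f i)) \<Longrightarrow> Ck k (\<lambda>x. \<Sum>i\<in>S. f i x)"
  by (induction S rule: finite_induct) (auto simp: Ck_const intro: Ck_add)

lemma Ck_laplacian: "Ck (Suc (Suc k)) f \<Longrightarrow> Ck k (laplacian f)"
  unfolding laplacian_def[abs_def] by (intro Ck_sum) auto

lemma DERIV_GDERIV_compose:
  assumes "GDERIV f (\<gamma> t) :> D" "(\<gamma> has_vector_derivative e) (at t)"
  shows "((\<lambda>t. f (\<gamma> t)) has_real_derivative e \<bullet> D) (at t)"
proof -
  have "((\<lambda>t. f (\<gamma> t)) has_derivative (\<lambda>h. (h *\<^sub>R e) \<bullet> D)) (at t)"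
    using has_derivative_compose[of \<gamma> "\<lambda>h. h *\<^sub>R e" t UNIV f "\<lambda>h. h \<bullet> D"] assms
    by (simp add: gderiv_def has_vector_derivative_def)
  then show ?thesis
    by (simp add: has_field_derivative_def mult.commute[of _ "e \<bullet> D"])
qed

section \<open>Weighted averages\<close>

text \<open>Base point \<open>b\<close> and direction \<open>e\<close> may both depend on y, so that
  one rule covers differentiation in the radius (e y = y), in the centre (e constant) and in a
  translation of the kernel.\<close>

lemma leibniz_line:
  fixes f :: "'a::euclidean_space \<Rightarrow> real"
  assumes G: "\<And>x. GDERIV f x :> G x" and cG: "continuous_on UNIV G"
    and cb: "continuous_on UNIV b" and ce: "continuous_on UNIV e" and cw: "continuous_on UNIV w"
  shows "((\<lambda>t. integral (cbox l u) (\<lambda>y. f (b y + t *\<^sub>R e y) * w y)) has_real_derivative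
           integral (cbox l u) (\<lambda>y. (e y \<bullet> G (b y + t *\<^sub>R e y)) * w y)) (at t)"
proof (rule leibniz_rule_field_derivative[where U = UNIV, simplified])
  have cf: "continuous_on UNIV f"
    using G unfolding gderiv_def by (meson continuous_at_imp_continuous_on has_derivative_continuous)
  note c = continuous_on_compose2[OF cf _ subset_UNIV] continuous_on_compose2[OF cG _ subset_UNIV]
    continuous_on_compose2[OF cb _ subset_UNIV] continuous_on_compose2[OF ce _ subset_UNIV]
    continuous_on_compose2[OF cw _ subset_UNIV]
  show "((\<lambda>s. f (b y + s *\<^sub>R e y) * w y) has_real_derivative (e y \<bullet> G (b y + s *\<^sub>R e y)) * w y) (at s)"
    for s y
    by (intro DERIV_cmult_right DERIV_GDERIV_compose G)
       (auto intro!: derivative_eq_intros simp: has_vector_derivative_def)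
  show "(\<lambda>y. f (b y + s *\<^sub>R e y) * w y) integrable_on cbox l u" for s
    by (intro integrable_continuous continuous_intros c)
  show "continuous_on (UNIV \<times> cbox l u) (\<lambda>(s, y). (e y \<bullet> G (b y + s *\<^sub>R e y)) * w y)"
    unfolding split_beta by (intro continuous_intros c)
qed

text \<open>The kernels vanish outside the unit ball; the wider box leaves room to translate them by
  vectors shorter than 1 without leaving the domain of integration.\<close>

definition cube :: "'a::euclidean_space set" where
  "cube = cbox (- 2 *\<^sub>R One) (2 *\<^sub>R One)"

lemma mem_cube: "norm y < 2 \<Longrightarrow> y \<in> cube"
proof -
  assume "norm y < 2"
  then have "\<bar>y \<bullet> b\<bar> \<le> 2" if "b \<in> Basis" for b
    using Basis_le_norm[OF that, of y] by linarith
  then show ?thesis unfolding cube_def mem_box by (auto simp: abs_le_iff) (smt (verit))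
qed

text \<open>Not normalised by the mass of \<open>w\<close>. Since R sits inside \<open>f\<close> and
  the domain is fixed, R = 0 is a legitimate scale and serves as the starting point when integrating
  in R.\<close>

definition wavg :: "('a::euclidean_space \<Rightarrow> real) \<Rightarrow> ('a \<Rightarrow> real) \<Rightarrow> real \<Rightarrow> 'a \<Rightarrow> real" where
  "wavg f w R x = integral cube (\<lambda>y. f (x + R *\<^sub>R y) * w y)"

lemma integral_eq_integral_UNIV:
  fixes f :: "'a::euclidean_space \<Rightarrow> real"
  assumes "\<And>y. y \<notin> S \<Longrightarrow> f y = 0"
  shows "integral S f = integral UNIV f"
proof -
  have "(\<lambda>x. if x \<in> S then f x else 0) = f" using assms by auto
  then show ?thesis using Henstock_Kurzweil_Integration.integral_restrict_UNIV[of S f] by simp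
qed

text \<open>Differentiate \<open>\<integral> f (x + R (y + t a)) g y dy =
  \<integral> f (x + R y) g (y - t a) dy\<close> at \<open>t = 0\<close>.\<close>

lemma wavg_by_parts:
  fixes f :: "'a::euclidean_space \<Rightarrow> real"
  assumes f: "\<And>x. GDERIV f x :> F x" "continuous_on UNIV F"
    and g: "\<And>x. GDERIV g x :> G x" "continuous_on UNIV G"
    and supp: "\<And>y. norm y \<ge> 1 \<Longrightarrow> g y = 0"
  shows "R * wavg (\<lambda>z. a \<bullet> F z) g R x = - wavg f (\<lambda>y. a \<bullet> G y) R x"
proof -
  have cf: "continuous_on UNIV f"
    using f unfolding gderiv_def by (meson continuous_at_imp_continuous_on has_derivative_continuous)
  have cg: "continuous_on UNIV g"
    using g unfolding gderiv_def by (meson continuous_at_imp_continuous_on has_derivative_continuous)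
  let ?F1 = "\<lambda>t. integral cube (\<lambda>y. f ((x + R *\<^sub>R y) + t *\<^sub>R (R *\<^sub>R a)) * g y)"
  let ?F2 = "\<lambda>t. integral cube (\<lambda>y. g (y + t *\<^sub>R (- a)) * f (x + R *\<^sub>R y))"
  have 1: "(?F1 has_real_derivative
      integral cube (\<lambda>y. (R *\<^sub>R a) \<bullet> F ((x + R *\<^sub>R y) + 0 *\<^sub>R (R *\<^sub>R a)) * g y)) (at 0)"
    unfolding cube_def by (intro leibniz_line f cg continuous_intros)
  have 2: "(?F2 has_real_derivative
      integral cube (\<lambda>y. (- a) \<bullet> G (y + 0 *\<^sub>R (- a)) * f (x + R *\<^sub>R y))) (at 0)"
    unfolding cube_def
    by (intro leibniz_line g continuous_intros continuous_on_compose2[OF cf _ subset_UNIV])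
  \<comment> \<open>Translation invariance: the bound on t gives |t a| < 1, so the shifted integrand
    is still supported in \<open>cube\<close> and both integrals equal the one over the whole space.
    The added 1 in the denominator covers a = 0.\<close>
  have eq: "?F1 t = ?F2 t" if t: "\<bar>t\<bar> < 1 / (norm a + 1)" for t
  proof -
    define c where "c = t *\<^sub>R a"
    have "\<bar>t\<bar> * (norm a + 1) < 1"
      using t by (simp add: pos_less_divide_eq add_nonneg_pos)
    then have c: "norm c < 1"
      by (simp add: c_def algebra_simps)
    define \<phi> where "\<phi> = (\<lambda>y. g (y - c) * f (x + R *\<^sub>R y))"
    have z1: "\<phi> y = 0" if "y \<notin> cube" for y
    proof -
      have "norm y \<ge> 2" using that mem_cube by force
      then have "norm (y - c) \<ge> 1" using c norm_triangle_ineq2[of y c] by linarith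
      then show ?thesis by (simp add: \<phi>_def supp)
    qed
    have z2: "\<phi> y = 0" if "y \<notin> cbox (- 2 *\<^sub>R One + c) (2 *\<^sub>R One + c)" for y
    proof -
      have "y - c \<notin> cube"
        using that unfolding cube_def by (auto simp: mem_box inner_diff_left inner_add_left algebra_simps)
      then have "norm (y - c) \<ge> 1" using mem_cube by force
      then show ?thesis by (simp add: \<phi>_def supp)
    qed
    have "?F1 t = integral cube (\<phi> \<circ> (+) c)"
      by (simp add: \<phi>_def c_def o_def algebra_simps)
    also have "\<dots> = integral UNIV \<phi>"
      unfolding cube_def integral_shift_cbox_plus using z2 by (rule integral_eq_integral_UNIV)
    also have "\<dots> = integral cube \<phi>"
      using z1 by (rule integral_eq_integral_UNIV[symmetric])
    finally show ?thesis by (simp add: \<phi>_def c_def)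
  qed
  have "(?F1 has_real_derivative
      integral cube (\<lambda>y. (- a) \<bullet> G (y + 0 *\<^sub>R (- a)) * f (x + R *\<^sub>R y))) (at 0)"
    by (rule has_field_derivative_transform_within_open[OF 2,
          where S = "{- (1 / (norm a + 1))<..<1 / (norm a + 1)}"])
       (use eq in \<open>auto simp: add_nonneg_pos\<close>)
  from DERIV_unique[OF 1 this] show ?thesis
    by (simp add: wavg_def algebra_simps)
qed

section \<open>Truncated powers and the bump kernels\<close>

lemma DERIV_pos_part_power:
  assumes "N \<ge> 1"
  shows "((\<lambda>s::real. max 0 s ^ Suc N) has_real_derivative real (Suc N) * max 0 s ^ N) (at s)"
proof (cases s "0::real" rule: linorder_cases)
  case less
  have "((\<lambda>s::real. 0) has_real_derivative 0) (at s)" by simp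
  then have "((\<lambda>s::real. max 0 s ^ Suc N) has_real_derivative 0) (at s)"
    by (rule has_field_derivative_transform_within_open[where S = "{..<0}"]) (use less in auto)
  then show ?thesis using less assms by (simp add: power_0_left)
next
  case equal
  \<comment> \<open>At the junction the difference quotient is at most |h|^N in absolute value,
    which tends to 0 exactly because N >= 1; the first power would have a corner here.\<close>
  have "((\<lambda>h. max 0 h ^ Suc N / h) \<longlongrightarrow> 0) (at (0::real))"
  proof (rule Lim_null_comparison)
    show "\<forall>\<^sub>F h in at 0. norm (max 0 h ^ Suc N / h) \<le> \<bar>h\<bar> ^ N"
      by (auto simp: max_def power_abs abs_mult intro!: always_eventually)
    have "((\<lambda>h::real. \<bar>h\<bar> ^ N) \<longlongrightarrow> \<bar>0\<bar> ^ N) (at 0)" by (intro tendsto_intros)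
    then show "((\<lambda>h::real. \<bar>h\<bar> ^ N) \<longlongrightarrow> 0) (at 0)"
      using assms by (metis abs_zero not_one_le_zero power_0_left)
  qed
  then show ?thesis using equal assms by (simp add: DERIV_def power_0_left)
next
  case greater
  have "((\<lambda>s::real. s ^ Suc N) has_real_derivative real (Suc N) * s ^ N) (at s)"
    using DERIV_pow[of "Suc N" s UNIV] by simp
  then have "((\<lambda>s::real. max 0 s ^ Suc N) has_real_derivative real (Suc N) * s ^ N) (at s)"
    by (rule has_field_derivative_transform_within_open[where S = "{0<..}"]) (use greater in auto)
  then show ?thesis using greater by simp
qed

text \<open>A radial family closed under differentiation: the gradient of one member is a scalar
  multiple of y times the previous member. For N = 0 the value is 1 everywhere, since 0 ^ 0 = 1, so
  compact support starts at N = 1.\<close>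

definition bump :: "nat \<Rightarrow> 'a::real_inner \<Rightarrow> real" where
  "bump N y = max 0 (1 - y \<bullet> y) ^ N"

lemma GDERIV_bump:
  assumes "N \<ge> 1"
  shows "GDERIV (bump (Suc N)) y :> (- 2 * real (Suc N) * bump N y) *\<^sub>R y"
proof -
  have "GDERIV (\<lambda>y::'a. 1 - y \<bullet> y) y :> (- 2) *\<^sub>R y"
    unfolding gderiv_def by (auto intro!: derivative_eq_intros simp: inner_commute)
  from GDERIV_DERIV_compose[OF this DERIV_pos_part_power[OF assms]]
  show ?thesis unfolding bump_def[abs_def]
    by (rule GDERIV_subst) (simp only: scaleR_scaleR mult_ac)
qed

lemma continuous_bump [continuous_intros]:
  assumes "continuous_on S f"
  shows "continuous_on S (\<lambda>x. bump N (f x))"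
  unfolding bump_def by (intro continuous_intros assms)

lemma bump_nonneg [simp]: "0 \<le> bump N y"
  by (simp add: bump_def)

lemma bump_le_1: "bump N y \<le> 1"
  by (simp add: bump_def power_le_one)

lemma bump_antimono: "M \<le> N \<Longrightarrow> bump N y \<le> bump M y"
  unfolding bump_def by (rule power_decreasing) auto

lemma bump_eq_0:
  assumes "norm y \<ge> 1" "N \<ge> 1"
  shows "bump N y = 0"
proof -
  have "y \<bullet> y \<ge> 1" using assms power_mono[of 1 "norm y" 2] by (simp add: dot_square_norm)
  then show ?thesis using assms(2) by (simp add: bump_def)
qed

text \<open>A continuous nonnegative function with zero integral over the box vanishes there, but
  every bump has value 1 at the origin. Positivity is what later allows division by the
  mass.\<close>

lemma bump_mass_pos: "integral (cube :: 'a::euclidean_space set) (bump N) > 0"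
proof -
  have c: "continuous_on (cube :: 'a set) (bump N)" by (intro continuous_intros)
  have "integral (cube :: 'a set) (bump N) \<ge> 0"
    using c unfolding cube_def by (intro integral_nonneg integrable_continuous) auto
  moreover have "integral (cube :: 'a set) (bump N) \<noteq> 0"
  proof
    assume 0: "integral (cube :: 'a set) (bump N) = 0"
    have "(bump N has_integral 0) (cube :: 'a set)"
      using 0 c integrable_continuous unfolding cube_def by (metis integrable_integral)
    then have "bump N (0::'a) = 0"
      unfolding cube_def
      by (rule has_integral_0_cbox_imp_0[rotated 2])
         (auto simp: mem_box box_ne_empty inner_Basis intro!: continuous_intros)
    then show False by (simp add: bump_def)
  qed
  ultimately show ?thesis by simp
qed

section \<open>Pizzetti's formula\<close>

lemma wavg_0: "wavg f w 0 x = f x * integral cube w"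
  by (simp add: wavg_def)

lemma integrable_cube: "continuous_on UNIV (f :: _ \<Rightarrow> real) \<Longrightarrow> f integrable_on cube"
  unfolding cube_def by (intro integrable_continuous) (auto intro: continuous_on_subset)

text \<open>Differentiating under the integral pairs y * \<open>bump N y\<close> with the gradient
  of \<open>f\<close>. That vector is -1 / (2 (N + 1)) times the gradient of the next bump, so
  integrating by parts in each coordinate produces the Laplacian and one factor R.\<close>

lemma DERIV_wavg_bump:
  fixes f :: "real^'n::finite \<Rightarrow> real"
  assumes f: "Ck 2 f" and N: "N \<ge> 1"
  shows "((\<lambda>R. wavg f (bump N) R x) has_real_derivative
           R / (2 * real (Suc N)) * wavg (laplacian f) (bump (Suc N)) R x) (at R)"
proof -
  have f1: "Ck (Suc 1) f" using f by (simp only: Suc_1)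
  have p: "Ck (Suc 0) (pdiff i f)" for i using Ck_pdiff[OF f1] by simp
  have pp: "Ck 0 (pdiff i (pdiff i f))" for i using Ck_pdiff[OF p] .
  note cp = continuous_on_compose2[OF Ck_imp_continuous[OF p] _ subset_UNIV]
  note cpp = continuous_on_compose2[OF Ck_imp_continuous[OF pp] _ subset_UNIV]
  define s where "s = 2 * real (Suc N)"
  have s: "s > 0" by (simp add: s_def)
  have "((\<lambda>R. wavg f (bump N) R x) has_real_derivative
      integral cube (\<lambda>y. (y \<bullet> grad f (x + R *\<^sub>R y)) * bump N y)) (at R)"
    unfolding wavg_def cube_def
    by (intro leibniz_line GDERIV_grad[OF f1] continuous_grad[OF f1] continuous_intros)
  moreover have "integral cube (\<lambda>y. (y \<bullet> grad f (x + R *\<^sub>R y)) * bump N y) =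
      R / s * wavg (laplacian f) (bump (Suc N)) R x"
  proof -
    have i: "s * integral cube (\<lambda>y. y $ i * pdiff i f (x + R *\<^sub>R y) * bump N y) =
        R * wavg (pdiff i (pdiff i f)) (bump (Suc N)) R x" for i
    proof -
      have "R * wavg (\<lambda>z. axis i 1 \<bullet> grad (pdiff i f) z) (bump (Suc N)) R x =
        - wavg (pdiff i f) (\<lambda>y. axis i 1 \<bullet> ((- s * bump N y) *\<^sub>R y)) R x"
        unfolding s_def
        by (rule wavg_by_parts[OF GDERIV_grad[OF p] continuous_grad[OF p]])
           (use GDERIV_bump[OF N] in \<open>auto intro!: continuous_intros simp: bump_eq_0\<close>)
      then show ?thesis
        by (simp add: inner_axis' grad_def wavg_def mult_ac flip: integral_mult_right)
    qed
    have "s * integral cube (\<lambda>y. (y \<bullet> grad f (x + R *\<^sub>R y)) * bump N y) =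
      s * integral cube (\<lambda>y. \<Sum>i\<in>UNIV. y $ i * pdiff i f (x + R *\<^sub>R y) * bump N y)"
      by (simp add: inner_vec_def grad_def sum_distrib_right)
    also have "\<dots> = (\<Sum>i\<in>UNIV. s * integral cube (\<lambda>y. y $ i * pdiff i f (x + R *\<^sub>R y) * bump N y))"
      by (subst integral_sum) (auto intro!: integrable_cube continuous_intros cp simp: sum_distrib_left)
    also have "\<dots> = R * integral cube (\<lambda>y. \<Sum>i\<in>UNIV. pdiff i (pdiff i f) (x + R *\<^sub>R y) * bump (Suc N) y)"
      unfolding i wavg_def
      by (subst integral_sum) (auto intro!: integrable_cube continuous_intros cpp simp: sum_distrib_left)
    also have "\<dots> = R * wavg (laplacian f) (bump (Suc N)) R x"
      by (simp add: wavg_def laplacian_def sum_distrib_right)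
    finally have "integral cube (\<lambda>y. (y \<bullet> grad f (x + R *\<^sub>R y)) * bump N y) * s = R * wavg (laplacian f) (bump (Suc N)) R x"
      by (simp only: mult.commute)
    then show ?thesis using s by (subst (asm) nonzero_eq_divide_eq[symmetric]) auto
  qed
  ultimately show ?thesis by (simp add: s_def)
qed

text \<open>The average has zero derivative in R, hence equals its value at R = 0.\<close>

lemma mean_value_harmonic:
  fixes f :: "real^'n::finite \<Rightarrow> real"
  assumes f: "Ck 2 f" and harm: "\<And>x. laplacian f x = 0" and N: "N \<ge> 1"
  shows "wavg f (bump N) R x = f x * integral cube (bump N :: real^'n \<Rightarrow> real)"
proof -
  have "((\<lambda>R. wavg f (bump N) R x) has_real_derivative 0) (at R)" for R
    using DERIV_wavg_bump[OF f N, of x R] harm by (simp add: wavg_def)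
  then have "wavg f (bump N) R x = wavg f (bump N) 0 x"
    using DERIV_isconst_all by blast
  then show ?thesis by (simp add: wavg_0)
qed

text \<open>The Laplacian of \<open>f\<close> is harmonic, so its averages do not depend on R and
  the R-derivative of the average of \<open>f\<close> is linear in R. Integrating from 0 gives the
  quadratic term, and halving 1 / (2 (N + 1)) gives the denominator.\<close>

lemma pizzetti_biharmonic:
  fixes f :: "real^'n::finite \<Rightarrow> real"
  assumes f: "Ck 4 f" and biharm: "\<And>x. bilaplacian f x = 0" and N: "N \<ge> 1"
  shows "wavg f (bump N) R x = f x * integral cube (bump N :: real^'n \<Rightarrow> real)
    + R\<^sup>2 * (laplacian f x * integral cube (bump (Suc N) :: real^'n \<Rightarrow> real) / (4 * real (Suc N)))"
proof -
  define C where "C = laplacian f x * integral cube (bump (Suc N) :: real^'n \<Rightarrow> real) / (4 * real (Suc N))"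
  have f4: "Ck (Suc (Suc 2)) f" using f by simp
  have f2: "Ck 2 f" by (rule Ck_Suc_imp_Ck[OF Ck_Suc_imp_Ck[OF f4]])
  have m: "wavg (laplacian f) (bump (Suc N)) R x
      = laplacian f x * integral cube (bump (Suc N) :: real^'n \<Rightarrow> real)" for R
    by (rule mean_value_harmonic[OF Ck_laplacian[OF f4]]) (use biharm in \<open>auto simp: bilaplacian_def\<close>)
  have cancel: "r / (2 * n) * X - 2 * r * (X / (4 * n)) = 0" for r n X :: real
    by simp
  have "((\<lambda>R. wavg f (bump N) R x - R\<^sup>2 * C) has_real_derivative 0) (at R)" for R
  proof (rule DERIV_cong)
    show "((\<lambda>R. wavg f (bump N) R x - R\<^sup>2 * C) has_real_derivative
        R / (2 * real (Suc N)) * wavg (laplacian f) (bump (Suc N)) R x - 2 * R * C) (at R)"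
      by (intro DERIV_diff DERIV_wavg_bump[OF f2 N]) (auto intro!: derivative_eq_intros)
    show "R / (2 * real (Suc N)) * wavg (laplacian f) (bump (Suc N)) R x - 2 * R * C = 0"
      unfolding m C_def by (rule cancel)
  qed
  then have "wavg f (bump N) R x - R\<^sup>2 * C = wavg f (bump N) 0 x - 0\<^sup>2 * C"
    using DERIV_isconst_all[of "\<lambda>R. wavg f (bump N) R x - R\<^sup>2 * C"] by blast
  then show ?thesis by (simp add: wavg_0 C_def)
qed

text \<open>The weights 4 and -1 cancel the Laplacian because 4 R^2 - (2 R)^2 = 0, and leave 4 - 1 =
  3 copies of the value of \<open>f\<close>.\<close>

lemma two_scale_mean_value:
  fixes f :: "real^'n::finite \<Rightarrow> real"
  assumes "Ck 4 f" and "\<And>x. bilaplacian f x = 0" and "N \<ge> 1"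
  shows "3 * integral cube (bump N :: real^'n \<Rightarrow> real) * f x
    = 4 * wavg f (bump N) R x - wavg f (bump N) (2 * R) x"
  unfolding pizzetti_biharmonic[OF assms] by (simp add: power_mult_distrib algebra_simps)

section \<open>Third derivatives through two-scale averages\<close>

lemma pdiff_wavg:
  fixes f :: "real^'n::finite \<Rightarrow> real"
  assumes f: "Ck (Suc k) f" and w: "continuous_on UNIV w"
  shows "((\<lambda>t. wavg f w R (x + t *\<^sub>R axis i 1)) has_real_derivative wavg (pdiff i f) w R x) (at 0)"
proof -
  have "((\<lambda>t. integral cube (\<lambda>y. f ((x + R *\<^sub>R y) + t *\<^sub>R axis i 1) * w y)) has_real_derivative
      integral cube (\<lambda>y. (axis i 1 \<bullet> grad f ((x + R *\<^sub>R y) + 0 *\<^sub>R axis i 1)) * w y)) (at 0)"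
    unfolding cube_def
    by (intro leibniz_line GDERIV_grad[OF f] continuous_grad[OF f] w continuous_intros)
  then show ?thesis by (simp add: wavg_def inner_axis' grad_def add_ac)
qed

text \<open>The identity holds at every centre, so it may be differentiated in the centre and is
  inherited by the partial derivatives. Iterating this reaches third derivatives of a C^4 function,
  which need not be C^4 themselves.\<close>

lemma pdiff_two_scale:
  fixes f :: "real^'n::finite \<Rightarrow> real"
  assumes f: "Ck (Suc k) f" and w: "continuous_on UNIV w"
    and mv: "\<And>x. c * f x = 4 * wavg f w R x - wavg f w (2 * R) x"
  shows "c * pdiff i f x = 4 * wavg (pdiff i f) w R x - wavg (pdiff i f) w (2 * R) x"
proof (rule DERIV_unique)
  let ?F = "\<lambda>t. c * f (x + t *\<^sub>R axis i 1)"
  show "(?F has_real_derivative c * pdiff i f x) (at 0)"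
    using DERIV_pdiff[of f i x 0] f by (auto intro!: DERIV_cmult)
  show "(?F has_real_derivative 4 * wavg (pdiff i f) w R x - wavg (pdiff i f) w (2 * R) x) (at 0)"
    unfolding mv by (intro DERIV_diff DERIV_cmult pdiff_wavg[OF f w])
qed

lemma pdiff_by_parts:
  fixes f :: "real^'n::finite \<Rightarrow> real"
  assumes f: "Ck (Suc k) f"
    and g: "\<And>x. GDERIV g x :> G x" "continuous_on UNIV G"
    and supp: "\<And>y. norm y \<ge> 1 \<Longrightarrow> g y = 0"
    and g': "\<And>y. G y $ i = g' y"
  shows "R * wavg (pdiff i f) g R x = - wavg f g' R x"
  using wavg_by_parts[OF GDERIV_grad[OF f] continuous_grad[OF f] g supp, of R "axis i 1" x]
  by (simp add: inner_axis' grad_def g')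

text \<open>Each integration by parts gains a factor R and lowers the bump exponent by at most one.
  Starting from exponent 4, three of them leave a continuous kernel dominated by
  \<open>bump 1\<close>, the same for all R and x.\<close>

lemma third_derivative_by_parts:
  fixes f :: "real^'n::finite \<Rightarrow> real"
  assumes f: "Ck 3 f"
  obtains g where "continuous_on UNIV g" "\<And>y. \<bar>g y\<bar> \<le> 336 * bump 1 y"
    "\<And>R x. R ^ 3 * wavg (pdiff i (pdiff j (pdiff k f))) (bump 4) R x = - wavg f g R x"
proof -
  have f3: "Ck (Suc 2) f" using f by simp
  have f2: "Ck (Suc 1) (pdiff k f)" using Ck_pdiff[OF f3] by (simp only: Suc_1)
  have f1: "Ck (Suc 0) (pdiff j (pdiff k f))" using Ck_pdiff[OF f2] by simp
  define d :: "'n \<Rightarrow> 'n \<Rightarrow> real" where "d = (\<lambda>a b. if a = b then 1 else 0)"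
  have [simp]: "axis a 1 $ b = d a b" for a b by (simp add: axis_def d_def)
  have G4: "GDERIV (bump 4) y :> (- 8 * bump 3 y) *\<^sub>R y" for y :: "real^'n"
    using GDERIV_bump[of 3 y] by simp
  have G3: "GDERIV (bump 3) y :> (- 6 * bump 2 y) *\<^sub>R y" for y :: "real^'n"
    using GDERIV_bump[of 2 y] by simp
  have G2: "GDERIV (bump 2) y :> (- 4 * bump 1 y) *\<^sub>R y" for y :: "real^'n"
    using GDERIV_bump[of 1 y] by (simp add: numeral_2_eq_2)
  have Gc: "GDERIV (\<lambda>y. y $ a) y :> axis a 1" for a and y :: "real^'n"
    unfolding gderiv_def
    by (simp add: inner_axis bounded_linear_imp_has_derivative bounded_linear_vec_nth)
  \<comment> \<open>\<open>g1\<close>, \<open>g2\<close>, \<open>g3\<close> are the successive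
    derivatives of \<open>bump 4\<close> in the directions i, j, k, with \<open>d\<close> as
    Kronecker delta.\<close>
  define g1 where "g1 = (\<lambda>y::real^'n. - 8 * (bump 3 y * y$i))"
  define g2 where "g2 = (\<lambda>y::real^'n. - 8 * (bump 3 y * d i j - 6 * bump 2 y * y$i * y$j))"
  define g3 where "g3 = (\<lambda>y::real^'n. - 8 * (- 6 * bump 2 y * y$k * d i j
       + 24 * bump 1 y * y$i * y$j * y$k - 6 * bump 2 y * (d i k * y$j + y$i * d j k)))"
  have D1: "GDERIV g1 y :> (- 8) *\<^sub>R (bump 3 y *\<^sub>R axis i 1 + (y$i) *\<^sub>R ((- 6 * bump 2 y) *\<^sub>R y))" for y
    unfolding g1_def
    using GDERIV_mult[OF GDERIV_const[of "- 8" y] GDERIV_mult[OF G3[of y] Gc[of i y]]] by simp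
  have D2: "GDERIV g2 y :> (- 8) *\<^sub>R (d i j *\<^sub>R ((- 6 * bump 2 y) *\<^sub>R y)
      - 6 *\<^sub>R ((bump 2 y * y$i) *\<^sub>R axis j 1 + (y$j) *\<^sub>R (bump 2 y *\<^sub>R axis i 1 + (y$i) *\<^sub>R ((- 4 * bump 1 y) *\<^sub>R y))))" for y
    unfolding g2_def
    using GDERIV_mult[OF GDERIV_const[of "- 8" y] GDERIV_diff[OF
        GDERIV_mult[OF G3[of y] GDERIV_const[of "d i j" y]]
        GDERIV_mult[OF GDERIV_const[of 6 y] GDERIV_mult[OF GDERIV_mult[OF G2[of y] Gc[of i y]] Gc[of j y]]]]]
    by (simp add: mult.assoc)
  have 1: "R * wavg (pdiff i (pdiff j (pdiff k f))) (bump 4) R x = - wavg (pdiff j (pdiff k f)) g1 R x" for R x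
    by (rule pdiff_by_parts[OF f1 G4]) (auto intro!: continuous_intros simp: bump_eq_0 g1_def)
  have 2: "R * wavg (pdiff j (pdiff k f)) g1 R x = - wavg (pdiff k f) g2 R x" for R x
    by (rule pdiff_by_parts[OF f2 D1])
       (auto intro!: continuous_intros simp: bump_eq_0 g1_def g2_def algebra_simps)
  have 3: "R * wavg (pdiff k f) g2 R x = - wavg f g3 R x" for R x
    by (rule pdiff_by_parts[OF f3 D2])
       (auto intro!: continuous_intros simp: bump_eq_0 g2_def g3_def algebra_simps)
  show ?thesis
  proof
    show "continuous_on UNIV g3" unfolding g3_def by (intro continuous_intros)
    \<comment> \<open>Inside the unit ball coordinates are at most 1 in absolute value and
      \<open>bump 2\<close> is at most \<open>bump 1\<close>: three terms with factor 48 give 144,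
      the cubic term gives 192, in total 336.\<close>
    show "\<bar>g3 y\<bar> \<le> 336 * bump 1 y" for y
    proof (cases "norm y \<ge> 1")
      case True
      then show ?thesis by (simp add: g3_def bump_eq_0)
    next
      case False
      have c: "\<bar>y$a\<bar> \<le> 1" for a using component_le_norm_cart[of y a] False by simp
      have dd: "\<bar>d a b\<bar> \<le> 1" for a b by (simp add: d_def)
      have b: "bump 2 y \<le> bump 1 y" by (rule bump_antimono) simp
      have m: "\<bar>p * q\<bar> \<le> 1" if "\<bar>p\<bar> \<le> 1" "\<bar>q\<bar> \<le> 1" for p q :: real
        using that by (simp add: abs_mult mult_le_one)
      have e: "g3 y = bump 2 y * (48 * (y$k * d i j) + 48 * (d i k * y$j) + 48 * (y$i * d j k))
          - 192 * (bump 1 y * (y$i * y$j * y$k))"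
        by (simp add: g3_def algebra_simps)
      have "\<bar>bump 2 y * (48 * (y$k * d i j) + 48 * (d i k * y$j) + 48 * (y$i * d j k))\<bar> \<le> bump 1 y * 144"
        unfolding abs_mult
        by (intro mult_mono) (use b m[OF c dd, of k i j] m[OF dd c, of i k j] m[OF c dd, of i j k] in auto)
      moreover have "\<bar>bump 1 y * (y$i * y$j * y$k)\<bar> \<le> bump 1 y"
        using mult_left_le[OF m[OF m[OF c c] c, of i j k] bump_nonneg[of 1 y]] by (simp add: abs_mult)
      ultimately show ?thesis unfolding e by linarith
    qed
    show "R ^ 3 * wavg (pdiff i (pdiff j (pdiff k f))) (bump 4) R x = - wavg f g3 R x" for R x
      using 1[of R x] 2[of R x] 3[of R x] by (simp add: power3_eq_cube mult.assoc)
  qed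
qed

section \<open>A Liouville theorem for biharmonic functions\<close>

lemma abs_wavg_le:
  fixes f :: "'a::euclidean_space \<Rightarrow> real"
  assumes f: "continuous_on UNIV f" and w: "continuous_on UNIV w" "\<And>y. \<bar>w y\<bar> \<le> M * bump 1 y"
  shows "\<bar>wavg f w R x\<bar> \<le> M * wavg (\<lambda>z. \<bar>f z\<bar>) (bump 1) R x"
proof -
  note cf = continuous_on_compose2[OF f _ subset_UNIV]
  have "\<bar>wavg f w R x\<bar> \<le> integral cube (\<lambda>y. M * (\<bar>f (x + R *\<^sub>R y)\<bar> * bump 1 y))"
    unfolding wavg_def real_norm_def[symmetric]
  proof (rule integral_norm_bound_integral)
    show "norm (f (x + R *\<^sub>R y) * w y) \<le> M * (norm (f (x + R *\<^sub>R y)) * bump 1 y)" for y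
      using mult_left_mono[OF w(2)[of y], of "\<bar>f (x + R *\<^sub>R y)\<bar>"] by (simp add: abs_mult mult_ac)
  qed (auto intro!: integrable_cube continuous_intros w cf)
  then show ?thesis by (simp add: wavg_def)
qed

text \<open>Turns a one-sided bound into a bound on |f|: only the positive part must be estimated,
  since the average of \<open>f\<close> itself is known from Pizzetti's formula.\<close>

lemma wavg_abs:
  fixes f :: "'a::euclidean_space \<Rightarrow> real"
  assumes f: "continuous_on UNIV f" and w: "continuous_on UNIV w"
  shows "wavg (\<lambda>z. \<bar>f z\<bar>) w R x = 2 * wavg (\<lambda>z. max 0 (f z)) w R x - wavg f w R x"
proof -
  note cf = continuous_on_compose2[OF f _ subset_UNIV]
  have "wavg (\<lambda>z. \<bar>f z\<bar>) w R x
      = integral cube (\<lambda>y. 2 * (max 0 (f (x + R *\<^sub>R y)) * w y) - f (x + R *\<^sub>R y) * w y)"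
    unfolding wavg_def by (rule integral_cong) (auto simp: max_def algebra_simps)
  also have "\<dots> = integral cube (\<lambda>y. 2 * (max 0 (f (x + R *\<^sub>R y)) * w y))
      - integral cube (\<lambda>y. f (x + R *\<^sub>R y) * w y)"
    by (rule integral_diff) (intro integrable_cube continuous_intros w cf; simp)+
  finally show ?thesis by (simp add: wavg_def)
qed

text \<open>The quadratic majorant contributes order R^2 on the scaled box, and rescaling shows that
  \<open>E\<close> contributes at most its total integral when R >= 1. \<open>E\<close> may be
  infinite at points, and \<open>ennreal\<close> maps negative reals to 0, so the hypothesis
  constrains the positive part of \<open>f\<close> only.\<close>

lemma wavg_pos_part_bound:
  fixes f :: "'a::euclidean_space \<Rightarrow> real" and E :: "'a \<Rightarrow> ennreal"
  assumes f: "continuous_on UNIV f" and "C \<ge> 0"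
    and le: "\<And>z. ennreal (f z) \<le> ennreal (C * (1 + (norm z)\<^sup>2)) + E z"
    and [measurable]: "E \<in> borel_measurable borel" and fin: "(\<integral>\<^sup>+z. E z \<partial>lborel) < \<infinity>"
  obtains K where "K \<ge> 0" "\<And>R. R \<ge> 1 \<Longrightarrow> wavg (\<lambda>z. max 0 (f z)) (bump 1) R x \<le> K * R\<^sup>2"
proof -
  note cf = continuous_on_compose2[OF f _ subset_UNIV]
  have "bounded (cube :: 'a set)" by (simp add: cube_def)
  then obtain D where D: "\<And>y. y \<in> (cube :: 'a set) \<Longrightarrow> norm y \<le> D" "D \<ge> 0"
    by (metis bounded_pos less_eq_real_def)
  have [measurable]: "(cube :: 'a set) \<in> sets borel" by (simp add: cube_def)
  define m where "m = measure lborel (cube :: 'a set)"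
  have m0: "m \<ge> 0" unfolding m_def by (rule measure_nonneg)
  have m: "emeasure lborel (cube :: 'a set) = ennreal m"
    using emeasure_lborel_cbox_finite[of "- 2 *\<^sub>R One :: 'a" "2 *\<^sub>R One"]
    unfolding m_def cube_def by (intro emeasure_eq_ennreal_measure) simp
  obtain e where e: "(\<integral>\<^sup>+z. E z \<partial>lborel) = ennreal e" "e \<ge> 0"
    using fin by (cases "\<integral>\<^sup>+z. E z \<partial>lborel" rule: ennreal_cases) auto
  define B where "B = C * (1 + (norm x + D)\<^sup>2)"
  have B: "B \<ge> 0" using \<open>C \<ge> 0\<close> by (simp add: B_def)
  show ?thesis
  proof
    show "B * m + e \<ge> 0" using B m0 e by simp
    fix R :: real assume R: "R \<ge> 1"
    have R2: "R\<^sup>2 \<ge> 1" using R by (simp add: one_le_power)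
    define g where "g = (\<lambda>y. max 0 (f (x + R *\<^sub>R y)) * bump 1 y)"
    have g0: "g y \<ge> 0" for y by (simp add: g_def)
    have cg: "continuous_on UNIV g" unfolding g_def by (intro continuous_intros cf; simp)
    \<comment> \<open>The substitution z = x + R y has Jacobian R^n, which is at least 1.\<close>
    have aff: "(\<integral>\<^sup>+y. E (x + R *\<^sub>R y) \<partial>lborel) \<le> ennreal e"
    proof -
      have "ennreal e = (\<integral>\<^sup>+z. E z \<partial>density (distr lborel borel (\<lambda>y. x + R *\<^sub>R y)) (\<lambda>_. \<bar>R\<bar>^DIM('a)))"
        using e lborel_affine[of R x] R by simp
      also have "\<dots> = ennreal (\<bar>R\<bar>^DIM('a)) * (\<integral>\<^sup>+y. E (x + R *\<^sub>R y) \<partial>lborel)"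
        by (simp add: nn_integral_density nn_integral_distr nn_integral_cmult)
      also have "\<dots> \<ge> 1 * (\<integral>\<^sup>+y. E (x + R *\<^sub>R y) \<partial>lborel)"
        by (intro mult_right_mono) (use R in \<open>auto simp: one_le_power\<close>)
      finally show ?thesis by simp
    qed
    have pt: "ennreal (g y) * indicator cube y \<le> ennreal (B * R\<^sup>2) * indicator cube y + E (x + R *\<^sub>R y)" for y
    proof (cases "y \<in> cube")
      case True
      have "norm (x + R *\<^sub>R y) \<le> norm x + R * D"
        by (rule order_trans[OF norm_triangle_ineq]) (use D(1)[OF True] R in simp)
      also have "\<dots> \<le> R * (norm x + D)"
        using mult_right_mono[OF R norm_ge_zero[of x]] by (simp add: algebra_simps)
      finally have "(norm (x + R *\<^sub>R y))\<^sup>2 \<le> R\<^sup>2 * (norm x + D)\<^sup>2"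
        unfolding power_mult_distrib[symmetric] by (intro power_mono) auto
      then have "1 + (norm (x + R *\<^sub>R y))\<^sup>2 \<le> R\<^sup>2 * (1 + (norm x + D)\<^sup>2)"
        using R2 by (simp add: algebra_simps)
      from mult_left_mono[OF this \<open>C \<ge> 0\<close>]
      have 1: "C * (1 + (norm (x + R *\<^sub>R y))\<^sup>2) \<le> B * R\<^sup>2"
        by (simp add: B_def mult_ac)
      have "g y \<le> max 0 (f (x + R *\<^sub>R y))"
        unfolding g_def by (intro mult_left_le bump_le_1) simp
      then have "ennreal (g y) \<le> ennreal (f (x + R *\<^sub>R y))"
        by (metis ennreal_leI ennreal_neg linorder_not_le max.absorb1 max.absorb2 less_imp_le ennreal_0)
      also have "\<dots> \<le> ennreal (C * (1 + (norm (x + R *\<^sub>R y))\<^sup>2)) + E (x + R *\<^sub>R y)"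
        by (rule le)
      also have "\<dots> \<le> ennreal (B * R\<^sup>2) + E (x + R *\<^sub>R y)"
        by (intro add_right_mono ennreal_leI 1)
      finally show ?thesis using True by simp
    qed simp
    have "(g has_integral (integral cube g)) cube"
      by (intro integrable_integral integrable_cube cg)
    then have "ennreal (integral cube g) = (\<integral>\<^sup>+y. ennreal (g y) * indicator cube y \<partial>lborel)"
      using nn_integral_has_integral_lebesgue'[of cube g] g0 by simp
    also have "\<dots> \<le> (\<integral>\<^sup>+y. ennreal (B * R\<^sup>2) * indicator cube y + E (x + R *\<^sub>R y) \<partial>lborel)"
      by (intro nn_integral_mono pt)
    also have "\<dots> = ennreal (B * R\<^sup>2) * ennreal m + (\<integral>\<^sup>+y. E (x + R *\<^sub>R y) \<partial>lborel)"
      by (subst nn_integral_add) (auto simp: nn_integral_cmult_indicator m)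
    also have "\<dots> \<le> ennreal (B * R\<^sup>2 * m) + ennreal e"
      using aff B m0 by (simp add: ennreal_mult add_left_mono)
    also have "\<dots> = ennreal (B * R\<^sup>2 * m + e)"
      using B m0 e by simp
    finally have "integral cube g \<le> B * R\<^sup>2 * m + e"
      by (subst (asm) ennreal_le_iff) (use B m0 e in auto)
    also have "\<dots> \<le> (B * m + e) * R\<^sup>2"
      using mult_left_mono[OF R2 e(2)] by (simp add: algebra_simps)
    finally show "wavg (\<lambda>z. max 0 (f z)) (bump 1) R x \<le> (B * m + e) * R\<^sup>2"
      by (simp add: wavg_def g_def)
  qed
qed

lemma third_derivative_eq_0:
  fixes f :: "real^'n::finite \<Rightarrow> real" and E :: "real^'n \<Rightarrow> ennreal"
  assumes f: "Ck 4 f" and biharm: "\<And>x. bilaplacian f x = 0" and "C \<ge> 0"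
    and le: "\<And>z. ennreal (f z) \<le> ennreal (C * (1 + (norm z)\<^sup>2)) + E z"
    and E: "E \<in> borel_measurable borel" "(\<integral>\<^sup>+z. E z \<partial>lborel) < \<infinity>"
  shows "pdiff i (pdiff j (pdiff k f)) x = 0"
proof -
  have f4: "Ck (Suc 3) f" using f by simp
  have f3: "Ck (Suc 2) (pdiff k f)" using Ck_pdiff[OF f4] by simp
  have f2: "Ck (Suc 1) (pdiff j (pdiff k f))" using Ck_pdiff[OF f3] by (simp only: Suc_1)
  have cf: "continuous_on UNIV f" by (rule Ck_imp_continuous[OF f])
  define T where "T = pdiff i (pdiff j (pdiff k f))"
  define c where "c = 3 * integral cube (bump 4 :: real^'n \<Rightarrow> real)"
  have c: "c > 0" using bump_mass_pos[where 'a="real^'n", of 4] by (simp add: c_def)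
  have cb: "continuous_on UNIV (bump 4 :: real^'n \<Rightarrow> real)" by (intro continuous_intros)
  \<comment> \<open>Three differentiations of the two-scale identity, one for each of k, j,
    i.\<close>
  have T: "c * T x = 4 * wavg T (bump 4) R x - wavg T (bump 4) (2 * R) x" for R
    unfolding T_def c_def
    by (intro pdiff_two_scale[OF f2 cb] pdiff_two_scale[OF f3 cb] pdiff_two_scale[OF f4 cb]
        two_scale_mean_value f biharm) simp
  obtain g where g: "continuous_on UNIV g" "\<And>y. \<bar>g y\<bar> \<le> 336 * bump 1 y"
    "\<And>R x. R ^ 3 * wavg T (bump 4) R x = - wavg f g R x"
    unfolding T_def using third_derivative_by_parts[OF Ck_Suc_imp_Ck[OF f4]] by metis
  obtain K where K: "K \<ge> 0" "\<And>R. R \<ge> 1 \<Longrightarrow> wavg (\<lambda>z. max 0 (f z)) (bump 1) R x \<le> K * R\<^sup>2"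
    using wavg_pos_part_bound[OF cf \<open>C \<ge> 0\<close> le E] by blast
  define a where "a = f x * integral cube (bump 1 :: real^'n \<Rightarrow> real)"
  define b where "b = laplacian f x * integral cube (bump (Suc 1) :: real^'n \<Rightarrow> real) / (4 * real (Suc 1))"
  \<comment> \<open>336 comes from the kernel bound, 2 K from twice the positive part, and |a| + |b|
    from Pizzetti's formula for \<open>bump 1\<close> at \<open>x\<close>.\<close>
  define P where "P = 336 * (2 * K + \<bar>a\<bar> + \<bar>b\<bar>)"
  have P: "P \<ge> 0" using K by (simp add: P_def)
  have bound: "\<bar>wavg T (bump 4) R x\<bar> \<le> P / R" if R: "R \<ge> 1" for R
  proof -
    have R2: "R\<^sup>2 \<ge> 1" using R by (simp add: one_le_power)
    have "\<bar>a\<bar> \<le> \<bar>a\<bar> * R\<^sup>2" using mult_left_mono[OF R2, of "\<bar>a\<bar>"] by simp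
    then have "- (a + R\<^sup>2 * b) \<le> (\<bar>a\<bar> + \<bar>b\<bar>) * R\<^sup>2"
      using mult_right_mono[of "- b" "\<bar>b\<bar>" "R\<^sup>2", OF abs_ge_minus_self] by (simp add: algebra_simps)
    moreover have "wavg f (bump 1) R x = a + R\<^sup>2 * b"
      unfolding a_def b_def by (rule pizzetti_biharmonic[OF f biharm]) simp
    moreover have "wavg (\<lambda>z. \<bar>f z\<bar>) (bump 1) R x
        = 2 * wavg (\<lambda>z. max 0 (f z)) (bump 1) R x - wavg f (bump 1) R x"
      by (rule wavg_abs[OF cf]) (intro continuous_intros)
    ultimately have "wavg (\<lambda>z. \<bar>f z\<bar>) (bump 1) R x \<le> (2 * K + \<bar>a\<bar> + \<bar>b\<bar>) * R\<^sup>2"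
      using K(2)[OF R] by (simp add: algebra_simps)
    then have "\<bar>wavg f g R x\<bar> \<le> P * R\<^sup>2"
      using abs_wavg_le[OF cf g(1,2), of R x] by (simp add: P_def algebra_simps)
    moreover have "R ^ 3 * \<bar>wavg T (bump 4) R x\<bar> = \<bar>wavg f g R x\<bar>"
      using arg_cong[OF g(3)[of R x], of abs] R by (simp add: abs_mult)
    ultimately have "R\<^sup>2 * (R * \<bar>wavg T (bump 4) R x\<bar>) \<le> R\<^sup>2 * P"
      by (simp add: power3_eq_cube power2_eq_square mult_ac)
    then have "R * \<bar>wavg T (bump 4) R x\<bar> \<le> P"
      using R by (subst (asm) mult_le_cancel_left_pos) auto
    then show ?thesis using R by (simp add: pos_le_divide_eq mult.commute)
  qed
  \<comment> \<open>5 = 4 + 1: four times the bound at scale R, plus the bound at scale 2 R relaxed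
    to P / R.\<close>
  have "\<bar>c * T x\<bar> \<le> 5 * P / R" if R: "R \<ge> 1" for R
  proof -
    have "P / (2 * R) \<le> P / R" using P R by (intro divide_left_mono) auto
    then show ?thesis
      using bound[OF R] bound[of "2 * R"] R unfolding T[of R] by (simp add: abs_le_iff)
  qed
  then have "\<forall>\<^sub>F R in at_top. \<bar>c * T x\<bar> \<le> 5 * P / R"
    using eventually_at_top_linorder by blast
  moreover have "((\<lambda>R. 5 * P / R) \<longlongrightarrow> 0) at_top"
    by (intro tendsto_divide_0[OF tendsto_const] filterlim_at_top_imp_at_infinity filterlim_ident)
  ultimately have "\<bar>c * T x\<bar> \<le> 0"
    by (intro tendsto_lowerbound) auto
  then show ?thesis using c by (simp add: T_def)
qed

section \<open>From vanishing third derivatives to a quadratic polynomial\<close>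

lemma eq_along_rays:
  fixes f :: "real^'n::finite \<Rightarrow> real" and \<phi> :: "real \<Rightarrow> real"
  assumes f: "Ck (Suc k) f"
    and \<phi>: "\<And>t. (\<phi> has_real_derivative (\<Sum>i\<in>UNIV. x$i * pdiff i f (t *\<^sub>R x))) (at t)"
  shows "f x = f 0 + \<phi> 1 - \<phi> 0"
proof -
  have "((\<lambda>t. f (t *\<^sub>R x)) has_real_derivative (\<Sum>i\<in>UNIV. x$i * pdiff i f (t *\<^sub>R x))) (at t)" for t
  proof -
    have "((\<lambda>t. f (t *\<^sub>R x)) has_real_derivative x \<bullet> grad f (t *\<^sub>R x)) (at t)"
      by (intro DERIV_GDERIV_compose GDERIV_grad[OF f])
         (auto intro!: derivative_eq_intros simp: has_vector_derivative_def)
    then show ?thesis by (simp add: inner_vec_def grad_def)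
  qed
  from DERIV_diff[OF this \<phi>] have "((\<lambda>t. f (t *\<^sub>R x) - \<phi> t) has_real_derivative 0) (at t)" for t
    by simp
  then have "f (1 *\<^sub>R x) - \<phi> 1 = f (0 *\<^sub>R x) - \<phi> 0"
    using DERIV_isconst_all[of "\<lambda>t. f (t *\<^sub>R x) - \<phi> t"] by blast
  then show ?thesis by simp
qed

text \<open>Integration along rays from the origin, three times: second derivatives are constant,
  hence first derivatives are affine, hence \<open>f\<close> is quadratic. The matrix is half the
  Hessian at 0.\<close>

lemma quadratic_if_third_derivative_eq_0:
  fixes f :: "real^'n::finite \<Rightarrow> real"
  assumes f: "Ck 3 f" and z: "\<And>i j k x. pdiff i (pdiff j (pdiff k f)) x = 0"
  shows "\<exists>(c::real) (b::real^'n) (A::real^'n^'n). \<forall>x.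
           f x = c + (\<Sum>i\<in>UNIV. b $ i * x $ i) + (\<Sum>i\<in>UNIV. \<Sum>j\<in>UNIV. A $ i $ j * x $ i * x $ j)"
proof -
  have f3: "Ck (Suc 2) f" using f by simp
  have f2: "Ck (Suc 1) (pdiff k f)" for k using Ck_pdiff[OF f3] by (simp only: Suc_1)
  have f1: "Ck (Suc 0) (pdiff j (pdiff k f))" for j k using Ck_pdiff[OF f2] by simp
  define a where "a = (\<lambda>j k. pdiff j (pdiff k f) 0)"
  define b where "b = (\<lambda>k. pdiff k f 0)"
  have 2: "pdiff j (pdiff k f) x = a j k" for j k x
    using eq_along_rays[OF f1, of "\<lambda>_. 0" x j k] z by (simp add: a_def)
  have 1: "pdiff k f x = b k + (\<Sum>j\<in>UNIV. x$j * a j k)" for k x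
  proof -
    let ?\<phi> = "\<lambda>t. t * (\<Sum>j\<in>UNIV. x$j * a j k)"
    have "(?\<phi> has_real_derivative (\<Sum>j\<in>UNIV. x$j * pdiff j (pdiff k f) (t *\<^sub>R x))) (at t)" for t
      unfolding 2 by (auto intro!: derivative_eq_intros)
    from eq_along_rays[OF f2 this] show ?thesis by (simp add: b_def)
  qed
  have 0: "f x = f 0 + (\<Sum>k\<in>UNIV. x$k * b k) + (\<Sum>k\<in>UNIV. x$k * (\<Sum>j\<in>UNIV. x$j * a j k)) / 2" for x
  proof -
    define p q where "p = (\<Sum>k\<in>UNIV. x$k * b k)" and "q = (\<Sum>k\<in>UNIV. x$k * (\<Sum>j\<in>UNIV. x$j * a j k))"
    have "(\<Sum>k\<in>UNIV. x$k * pdiff k f (t *\<^sub>R x)) = p + t * q" for t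
      unfolding 1 p_def q_def
      by (simp add: algebra_simps sum.distrib sum_distrib_left)
    then have "f x = f 0 + (1 * p + 1\<^sup>2 * (q / 2)) - (0 * p + 0\<^sup>2 * (q / 2))"
      by (intro eq_along_rays[OF f3, of "\<lambda>t. t * p + t\<^sup>2 * (q / 2)"])
         (auto intro!: derivative_eq_intros)
    then show ?thesis by (simp add: p_def q_def)
  qed
  show ?thesis
  proof (intro exI allI)
    show "f x = f 0 + (\<Sum>i\<in>UNIV. (\<chi> k. b k) $ i * x $ i)
        + (\<Sum>i\<in>UNIV. \<Sum>j\<in>UNIV. (\<chi> i j. a j i / 2) $ i $ j * x $ i * x $ j)" for x
      unfolding 0[of x] by (simp add: sum_distrib_left sum_divide_distrib mult_ac)
  qed
qed

theorem biharmonic_liouville: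
  fixes f :: "real^'n::finite \<Rightarrow> real" and E :: "real^'n \<Rightarrow> ennreal"
  assumes f: "Ck 4 f" and biharm: "\<And>x. bilaplacian f x = 0" and "C \<ge> 0"
    and le: "\<And>z. ennreal (f z) \<le> ennreal (C * (1 + (norm z)\<^sup>2)) + E z"
    and E: "E \<in> borel_measurable borel" "(\<integral>\<^sup>+z. E z \<partial>lborel) < \<infinity>"
  shows "\<exists>(c::real) (b::real^'n) (A::real^'n^'n). \<forall>x.
           f x = c + (\<Sum>i\<in>UNIV. b $ i * x $ i) + (\<Sum>i\<in>UNIV. \<Sum>j\<in>UNIV. A $ i $ j * x $ i * x $ j)"
  by (rule quadratic_if_third_derivative_eq_0)
     (use f Ck_Suc_imp_Ck[of 3 f] third_derivative_eq_0[OF assms] in auto)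

section \<open>Logarithmic potentials\<close>

text \<open>For 0 < |z| < 1, -ln |z| is at most the number of naturals n with |z| < exp (-n).
  Summing the volumes of these balls gives a geometric series with ratio exp (-dim).\<close>

lemma nn_integral_log_kernel:
  "(\<integral>\<^sup>+(z::'a::euclidean_space). ennreal (- ln (norm z)) * indicator (ball 0 1) z \<partial>lborel) < \<infinity>"
proof -
  let ?V = "unit_ball_vol (real DIM('a))"
  define q where "q = exp (- real DIM('a))"
  have q: "0 < q" "q < 1" by (simp_all add: q_def)
  have pt: "ennreal (- ln (norm z)) * indicator (ball 0 1) z
      \<le> (\<Sum>n. indicator (ball 0 (exp (- real n))) z)" for z :: 'a
  \<comment> \<open>At the origin the convention \<open>ln 0 = 0\<close> makes the left side 0; for
    |z| >= 1 the indicator does.\<close>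
  proof (cases "z = 0 \<or> norm z \<ge> 1")
    case True
    then show ?thesis by auto
  next
    case False
    define s where "s = - ln (norm z)"
    define m where "m = nat \<lceil>s\<rceil>"
    have s: "s > 0" using False by (simp add: s_def)
    have zs: "norm z = exp (- s)" using False by (simp add: s_def)
    have "indicator (ball 0 (exp (- real n))) z = (1::ennreal)" if "n < m" for n
    proof -
      have "real n < s" using that s unfolding m_def by linarith
      then show ?thesis by (simp add: zs)
    qed
    then have "(\<Sum>n<m. indicator (ball 0 (exp (- real n))) z) = ennreal (real m)"
      by (simp add: ennreal_of_nat_eq_real_of_nat)
    moreover have "(\<Sum>n<m. indicator (ball 0 (exp (- real n))) z) \<le> (\<Sum>n. indicator (ball 0 (exp (- real n))) z :: ennreal)"
      by (rule sum_le_suminf) auto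
    moreover have "ennreal s \<le> ennreal (real m)"
      unfolding m_def by (intro ennreal_leI) linarith
    ultimately have "ennreal s \<le> (\<Sum>n. indicator (ball 0 (exp (- real n))) z)"
      by (metis order_trans)
    then show ?thesis using False by (simp add: s_def)
  qed
  have "(\<integral>\<^sup>+(z::'a). ennreal (- ln (norm z)) * indicator (ball 0 1) z \<partial>lborel)
      \<le> (\<integral>\<^sup>+(z::'a). (\<Sum>n. indicator (ball 0 (exp (- real n))) z) \<partial>lborel)"
    by (intro nn_integral_mono pt)
  also have "\<dots> = (\<Sum>n. \<integral>\<^sup>+(z::'a). indicator (ball 0 (exp (- real n))) z \<partial>lborel)"
    by (rule nn_integral_suminf) (simp add: borel_measurable_indicator)
  also have "\<dots> = (\<Sum>n. ennreal (?V * q ^ n))"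
    by (simp add: emeasure_ball q_def exp_of_nat_mult[symmetric] mult.commute)
  also have "\<dots> = ennreal (\<Sum>n. ?V * q ^ n)"
    using q by (intro suminf_ennreal_eq sums_ennreal[THEN iffD2] summable_sums summable_mult summable_geometric) auto
  finally show ?thesis by (simp add: order.strict_trans1)
qed

text \<open>\<open>W\<close> is the convolution of |\<rho>| with the truncated logarithmic kernel,
  so Tonelli and translation invariance make its integral the product of the two integrals.\<close>

lemma nn_integral_log_potential:
  fixes \<rho> :: "'a::euclidean_space \<Rightarrow> real"
  assumes "integrable lborel \<rho>"
  defines "W \<equiv> \<lambda>x. \<integral>\<^sup>+y. ennreal (- ln (norm (x - y)) * \<bar>\<rho> y\<bar>) * indicator (ball x 1) y \<partial>lborel"
  shows "W \<in> borel_measurable borel" "(\<integral>\<^sup>+x. W x \<partial>lborel) < \<infinity>"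
proof -
  have [measurable]: "\<rho> \<in> borel_measurable borel" using assms by auto
  define k where "k = (\<lambda>z::'a. ennreal (- ln (norm z)) * indicator (ball 0 1) z)"
  have [measurable]: "k \<in> borel_measurable borel"
    unfolding k_def by (intro borel_measurable_times_ennreal borel_measurable_indicator) auto
  have W: "W x = (\<integral>\<^sup>+y. k (x - y) * ennreal \<bar>\<rho> y\<bar> \<partial>lborel)" for x
    unfolding W_def
  proof (intro nn_integral_cong)
    fix y
    have "indicator (ball x 1) y = (indicator (ball 0 1) (x - y) :: ennreal)"
      by (simp add: indicator_def dist_norm norm_minus_commute)
    moreover have "ennreal (- ln (norm (x - y)) * \<bar>\<rho> y\<bar>) = ennreal (- ln (norm (x - y))) * ennreal \<bar>\<rho> y\<bar>"
      by (rule ennreal_mult'') simp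
    ultimately show "ennreal (- ln (norm (x - y)) * \<bar>\<rho> y\<bar>) * indicator (ball x 1) y = k (x - y) * ennreal \<bar>\<rho> y\<bar>"
      by (simp only: k_def mult_ac)
  qed
  show "W \<in> borel_measurable borel"
    unfolding W[abs_def] by measurable
  have "(\<integral>\<^sup>+x. W x \<partial>lborel) = (\<integral>\<^sup>+y. \<integral>\<^sup>+x. k (x - y) * ennreal \<bar>\<rho> y\<bar> \<partial>lborel \<partial>lborel)"
    unfolding W by (intro lborel_pair.Fubini') measurable
  also have "\<dots> = (\<integral>\<^sup>+y. (\<integral>\<^sup>+z. k z \<partial>lborel) * ennreal \<bar>\<rho> y\<bar> \<partial>lborel)"
  proof (intro nn_integral_cong)
    fix y
    have "(\<integral>\<^sup>+z. k z \<partial>lborel) = (\<integral>\<^sup>+z. k z \<partial>distr lborel borel ((+) (- y)))"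
      by (simp add: lborel_distr_plus)
    also have "\<dots> = (\<integral>\<^sup>+x. k (x - y) \<partial>lborel)"
      by (simp add: nn_integral_distr)
    finally show "(\<integral>\<^sup>+x. k (x - y) * ennreal \<bar>\<rho> y\<bar> \<partial>lborel) = (\<integral>\<^sup>+z. k z \<partial>lborel) * ennreal \<bar>\<rho> y\<bar>"
      by (simp add: nn_integral_multc)
  qed
  also have "\<dots> = (\<integral>\<^sup>+z. k z \<partial>lborel) * (\<integral>\<^sup>+y. ennreal \<bar>\<rho> y\<bar> \<partial>lborel)"
    by (simp add: nn_integral_cmult)
  also have "\<dots> < \<infinity>"
    using nn_integral_log_kernel[where 'a='a] assms(1)
    by (auto simp: k_def ennreal_mult_less_top integrable_iff_bounded)
  finally show "(\<integral>\<^sup>+x. W x \<partial>lborel) < \<infinity>" .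
qed

text \<open>An inequality rather than an equality: without integrability the Bochner integral is 0
  by convention, so the bound holds in that case too.\<close>

lemma ennreal_set_lebesgue_integral_le:
  fixes f :: "'a \<Rightarrow> real"
  assumes "\<And>y. y \<in> A \<Longrightarrow> f y \<ge> 0"
  shows "ennreal (LINT y:A|M. f y) \<le> (\<integral>\<^sup>+y. ennreal (f y) * indicator A y \<partial>M)"
proof (cases "set_integrable M A f")
  case True
  have "(\<integral>\<^sup>+y. ennreal (indicator A y *\<^sub>R f y) \<partial>M) = ennreal (LINT y:A|M. f y)"
    using True assms unfolding set_lebesgue_integral_def set_integrable_def
    by (intro nn_integral_eq_integral) (auto simp: indicator_def)
  moreover have "(\<integral>\<^sup>+y. ennreal (indicator A y *\<^sub>R f y) \<partial>M) = (\<integral>\<^sup>+y. ennreal (f y) * indicator A y \<partial>M)"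
    by (intro nn_integral_cong) (auto simp: indicator_def)
  ultimately show ?thesis by simp
next
  case False
  then show ?thesis
    by (simp add: set_lebesgue_integral_def set_integrable_def not_integrable_integral_eq)
qed

section \<open>The one-sided bound on \<open>h\<close> and the conclusion\<close>

theorem theorem3p1:
  fixes p :: real and u v h :: "real^4 \<Rightarrow> real" and \<Lambda> :: real
  assumes p_pos: "p > 0"
    and u_C4: "Ck 4 u"
    and u_eq: "\<forall>x. bilaplacian u x = (1 - norm x powr p) * exp (4 * u x)"
    and u_L1: "integrable lborel (\<lambda>y. (1 - norm y powr p) * exp (4 * u y))"
    and Lambda_def: "\<Lambda> = (\<integral>y. (1 - norm y powr p) * exp (4 * u y) \<partial>lborel)"
    and v_def: "\<forall>x. v x = 1 / (8 * pi\<^sup>2) *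
        (\<integral>y. ln (norm y / norm (x - y)) * ((1 - norm y powr p) * exp (4 * u y)) \<partial>lborel)"
    and v_loc: "\<forall>r. set_integrable lborel (cball 0 r) v"
    and v_bound: "\<forall>\<epsilon>>0. \<exists>R>0. \<forall>x. norm x \<ge> R \<longrightarrow>
        - v x \<le> 1 / (8 * pi\<^sup>2) * (\<Lambda> + 5 * \<epsilon>) * ln (norm x)
               + 1 / (8 * pi\<^sup>2) * (LINT y:ball x 1|lborel.
                    ln (norm (x - y)) * ((1 - norm y powr p) * exp (4 * u y)))"
    and h_C4: "Ck 4 h"
    and h_biharm: "\<forall>x. bilaplacian h x = 0"
    and h_le: "\<forall>x. h x \<le> u x - v x"
  shows "\<exists>(c::real) (b::real^4) (A::real^4^4). \<forall>x.
           h x = c + (\<Sum>i\<in>UNIV. b $ i * x $ i) + (\<Sum>i\<in>UNIV. \<Sum>j\<in>UNIV. A $ i $ j * x $ i * x $ j)"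
proof -
  define \<rho> where "\<rho> = (\<lambda>y::real^4. (1 - norm y powr p) * exp (4 * u y))"
  define W where "W = (\<lambda>x::real^4. \<integral>\<^sup>+y. ennreal (- ln (norm (x - y)) * \<bar>\<rho> y\<bar>) * indicator (ball x 1) y \<partial>lborel)"
  have \<rho>: "integrable lborel \<rho>" using u_L1 by (simp add: \<rho>_def)
  then have [measurable]: "\<rho> \<in> borel_measurable borel" by auto
  have W[measurable]: "W \<in> borel_measurable borel" and finW: "(\<integral>\<^sup>+x. W x \<partial>lborel) < \<infinity>"
    unfolding W_def by (rule nn_integral_log_potential[OF \<rho>])+
  obtain R0 where R0: "\<And>x. norm x \<ge> R0 \<Longrightarrow> - v x \<le> 1 / (8 * pi\<^sup>2) * (\<Lambda> + 5) * ln (norm x)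
      + 1 / (8 * pi\<^sup>2) * (LINT y:ball x 1|lborel. ln (norm (x - y)) * \<rho> y)"
    using v_bound[rule_format, of 1] unfolding \<rho>_def by auto
  \<comment> \<open>Radius at least 3 puts the unit ball around any z with |z| > R inside |y| >= 2,
    where \<rho> is nonpositive.\<close>
  define R where "R = max R0 3"
  define \<kappa> where "\<kappa> = 1 / (8 * pi\<^sup>2)"
  have \<kappa>: "\<kappa> \<ge> 0" by (simp add: \<kappa>_def)
  \<comment> \<open>The least value of |y|^p - 1 on |y| >= 2; there |\<rho>| dominates \<delta> exp
    (4 u).\<close>
  define \<delta> where "\<delta> = 2 powr p - 1"
  have \<delta>: "\<delta> > 0" using p_pos by (simp add: \<delta>_def)
  have far: "\<rho> y \<le> 0" "exp (4 * u y) \<le> \<bar>\<rho> y\<bar> / \<delta>" if "norm y \<ge> 2" for y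
  proof -
    have "2 powr p \<le> norm y powr p" using that p_pos by (intro powr_mono2) auto
    then have le: "1 - norm y powr p \<le> - \<delta>" by (simp add: \<delta>_def)
    then show "\<rho> y \<le> 0" using \<delta> by (auto simp: \<rho>_def intro!: mult_nonpos_nonneg)
    have "\<delta> * exp (4 * u y) \<le> (norm y powr p - 1) * exp (4 * u y)"
      using le by (intro mult_right_mono) auto
    also have "\<dots> = \<bar>\<rho> y\<bar>" using le \<delta> by (simp add: \<rho>_def abs_mult)
    finally show "exp (4 * u y) \<le> \<bar>\<rho> y\<bar> / \<delta>" using \<delta> by (simp add: pos_le_divide_eq mult.commute)
  qed
  have "continuous_on (cball 0 R) h"
    using Ck_imp_continuous[OF h_C4] continuous_on_subset by blast
  then have "bounded (h ` cball 0 R)"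
    by (intro compact_imp_bounded compact_continuous_image) auto
  then obtain M where "M > 0" "\<And>x. norm x \<le> R \<Longrightarrow> \<bar>h x\<bar> \<le> M"
    unfolding bounded_pos by auto
  then have M: "\<And>x. norm x \<le> R \<Longrightarrow> h x \<le> M" "M \<ge> 0"
    by (auto intro: order_trans[OF abs_ge_self])
  \<comment> \<open>The first term majorises \<open>u\<close> away from the origin, the second the
    local logarithmic integral in the bound for -v.\<close>
  define E where "E = (\<lambda>x. ennreal (\<bar>\<rho> x\<bar> / \<delta>) + ennreal \<kappa> * W x)"
  \<comment> \<open>\<open>M\<close> covers the ball of radius \<open>R\<close>, the other term the
    logarithmic growth outside; the absolute value allows \<Lambda> + 5 to be negative.\<close>
  define C where "C = M + \<kappa> * \<bar>\<Lambda> + 5\<bar>"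
  have plus_le: "ennreal (a + b) \<le> ennreal a + ennreal b" for a b
    by (auto simp: ennreal_plus_if intro!: ennreal_leI)
  show ?thesis
  proof (rule biharmonic_liouville[OF h_C4 h_biharm[rule_format]])
    show "0 \<le> C" using M \<kappa> by (simp add: C_def)
    show "E \<in> borel_measurable borel" unfolding E_def by measurable
    have "(\<integral>\<^sup>+z. E z \<partial>lborel) = (\<integral>\<^sup>+z. ennreal (\<bar>\<rho> z\<bar> / \<delta>) \<partial>lborel) + ennreal \<kappa> * (\<integral>\<^sup>+z. W z \<partial>lborel)"
      unfolding E_def by (simp add: nn_integral_add nn_integral_cmult)
    moreover have "(\<integral>\<^sup>+z. ennreal (\<bar>\<rho> z\<bar> / \<delta>) \<partial>lborel) < \<infinity>"
    proof -
      have "integrable lborel (\<lambda>z. \<bar>\<rho> z\<bar> / \<delta>)" using \<rho> by simp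
      then show ?thesis using \<delta> by (simp add: integrable_iff_bounded)
    qed
    ultimately show "(\<integral>\<^sup>+z. E z \<partial>lborel) < \<infinity>"
      using finW by (simp add: ennreal_mult_less_top)
    fix z :: "real^4"
    show "ennreal (h z) \<le> ennreal (C * (1 + (norm z)\<^sup>2)) + E z"
    proof (cases "norm z \<le> R")
      case True
      have "M \<le> C" using \<kappa> by (simp add: C_def)
      also have "C \<le> C * (1 + (norm z)\<^sup>2)" using \<open>0 \<le> C\<close> by (simp add: algebra_simps)
      finally have "h z \<le> C * (1 + (norm z)\<^sup>2)" using M(1)[OF True] by simp
      then show ?thesis by (meson add_increasing2 ennreal_leI zero_le order_trans le_add_same_cancel1)
    next
      case False
      then have z: "norm z \<ge> R0" "norm z \<ge> 3" by (auto simp: R_def)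
      define L where "L = (LINT y:ball z 1|lborel. ln (norm (z - y)) * \<rho> y)"
      \<comment> \<open>On this ball both the logarithm and \<rho> are nonpositive, so their product
        is the nonnegative integrand of \<open>W\<close>; at y = z the logarithm is 0 by
        convention.\<close>
      have nn: "ln (norm (z - y)) * \<rho> y = - ln (norm (z - y)) * \<bar>\<rho> y\<bar>"
               "ln (norm (z - y)) * \<rho> y \<ge> 0" if "y \<in> ball z 1" for y
      proof -
        have d: "norm (z - y) < 1" using that by (simp add: dist_norm)
        have "norm y \<ge> 2" using norm_triangle_ineq2[of z y] d z by linarith
        then have r: "\<rho> y \<le> 0" by (rule far)
        have "ln (norm (z - y)) \<le> 0"
          using d by (cases "z = y") auto
        then show "ln (norm (z - y)) * \<rho> y \<ge> 0" using r by (simp add: mult_nonpos_nonpos)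
        show "ln (norm (z - y)) * \<rho> y = - ln (norm (z - y)) * \<bar>\<rho> y\<bar>" using r by simp
      qed
      have "ennreal L \<le> (\<integral>\<^sup>+y. ennreal (ln (norm (z - y)) * \<rho> y) * indicator (ball z 1) y \<partial>lborel)"
        unfolding L_def by (rule ennreal_set_lebesgue_integral_le) (rule nn)
      also have "\<dots> = W z"
        unfolding W_def by (intro nn_integral_cong) (use nn in \<open>auto simp: indicator_def\<close>)
      finally have LW: "ennreal (\<kappa> * L) \<le> ennreal \<kappa> * W z"
        using \<kappa> by (simp add: ennreal_mult' mult_left_mono)
      have "ln (norm z) \<le> norm z - 1" using z by (intro ln_le_minus_one) linarith
      moreover have "norm z \<le> (norm z)\<^sup>2" using z power_increasing[of 1 2 "norm z"] by simp
      ultimately have "ln (norm z) \<le> 1 + (norm z)\<^sup>2" by linarith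
      then have "\<bar>\<Lambda> + 5\<bar> * ln (norm z) \<le> \<bar>\<Lambda> + 5\<bar> * (1 + (norm z)\<^sup>2)"
        by (intro mult_left_mono) auto
      moreover have "(\<Lambda> + 5) * ln (norm z) \<le> \<bar>\<Lambda> + 5\<bar> * ln (norm z)"
        using z by (intro mult_right_mono) auto
      ultimately have "\<kappa> * ((\<Lambda> + 5) * ln (norm z)) \<le> \<kappa> * (\<bar>\<Lambda> + 5\<bar> * (1 + (norm z)\<^sup>2))"
        using \<kappa> by (intro mult_left_mono) auto
      also have "\<dots> \<le> C * (1 + (norm z)\<^sup>2)"
        unfolding C_def mult.assoc[symmetric] using M by (intro mult_right_mono) auto
      finally have "- v z \<le> C * (1 + (norm z)\<^sup>2) + \<kappa> * L"
        using R0[OF z(1)] by (simp add: \<kappa>_def L_def)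
      \<comment> \<open>With q = |\<rho> z| / \<delta> >= 0, the chain 4 u + 1 <= exp (4 u) <= q
        gives u <= q.\<close>
      moreover have "u z \<le> \<bar>\<rho> z\<bar> / \<delta>"
        using far(2)[of z] z exp_ge_add_one_self[of "4 * u z"] divide_nonneg_pos[of "\<bar>\<rho> z\<bar>" \<delta>] \<delta> by linarith
      ultimately have "h z \<le> C * (1 + (norm z)\<^sup>2) + (\<bar>\<rho> z\<bar> / \<delta> + \<kappa> * L)"
        using h_le[rule_format, of z] by linarith
      then have "ennreal (h z) \<le> ennreal (C * (1 + (norm z)\<^sup>2) + (\<bar>\<rho> z\<bar> / \<delta> + \<kappa> * L))"
        by (rule ennreal_leI)
      also have "\<dots> \<le> ennreal (C * (1 + (norm z)\<^sup>2)) + (ennreal (\<bar>\<rho> z\<bar> / \<delta>) + ennreal (\<kappa> * L))"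
        by (meson add_left_mono plus_le order_trans)
      also have "\<dots> \<le> ennreal (C * (1 + (norm z)\<^sup>2)) + E z"
        unfolding E_def by (intro add_left_mono LW)
      finally show ?thesis .
    qed
  qed
qed

end
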